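(* Let $(G,\cdot,\rhd,\lhd,\Phi)$ be a two-sided twisted post-group with sub-adjacent operation $\circ$. Define $\bullet:G\times G\to G$ by $$a\bullet b=(a\circ 1^{\dagger})\circ b,\quad\forall a,b\in G.$$ Then $(G,\cdot,\bullet)$ is a two-sided skew brace.
   Context: A left twisted post-group $(G,\cdot,\rhd,\Phi)$ is a group $(G,\cdot)$ with identity $1$ and maps $\rhd:G\times G\to G$, $\Phi:G\to G$ such that, setting $a\circ b=\Phi(a)\cdot(a\rhd b)$ (sub-adjacent operation), for all $a,b,c\in G$: $L_a^{\rhd}:b\mapsto a\rhd b$ is an automorphism of $(G,\cdot)$; $(a\circ b)\rhd c=a\rhd(b\rhd c)$; $\Phi(a\circ b)=a\circ\Phi(b)$. A right twisted post-group $(G,\cdot,\lhd,\Phi)$ is a group $(G,\cdot)$ with maps $\lhd:G\times G\to G$, $\Phi:G\to G$ such that, setting $a\circ b=(a\lhd b)\cdot\Phi(b)$ (sub-adjacent operation), for all $a,b,c\in G$: $a\mapsto a\lhd b$ is an automorphism of $(G,\cdot)$; $a\lhd(b\circ c)=(a\lhd b)\lhd c$; $\Phi(a\circ b)=\Phi(a)\circ b$. A two-sided twisted post-group is a quintuple $(G,\cdot,\rhd,\lhd,\Phi)$ such that $(G,\cdot,\rhd,\Phi)$ is a left twisted post-group, $(G,\cdot,\lhd,\Phi)$ is a right twisted post-group, and both have the same sub-adjacent operation $\circ$. For $a\in G$ put $e_a=(L_a^{\rhd})^{-1}(\Phi(a)^{-1}\cdot a)$ and $a^{\dagger}=(L_a^{\rhd})^{-1}(\Phi(a)^{-1}\cdot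 e_a)$ (inverses of elements in $(G,\cdot)$); $1^\dagger$ is the case $a=1$. A skew left brace $(G,\cdot,\circ)$ is a set with two group structures such that $a\circ(b\cdot c)=(a\circ b)\cdot a^{-1}\cdot(a\circ c)$; a skew right brace instead satisfies $(a\cdot b)\circ c=(a\circ c)\cdot c^{-1}\cdot(b\circ c)$ (inverses in $(G,\cdot)$). A two-sided skew brace is both a skew left brace and a skew right brace. *)

theory Defs
  imports "HOL-Algebra.Group"
begin

definition left_subadjacent ::
  "('a, 'm) monoid_scheme \<Rightarrow> ('a \<Rightarrow> 'a \<Rightarrow> 'a) \<Rightarrow> ('a \<Rightarrow> 'a) \<Rightarrow> 'a \<Rightarrow> 'a \<Rightarrow> 'a"
  where "left_subadjacent G rhd \<Phi> a b = \<Phi> a \<otimes>\<^bsub>G\<^esub> rhd a b"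

definition right_subadjacent ::
  "('a, 'm) monoid_scheme \<Rightarrow> ('a \<Rightarrow> 'a \<Rightarrow> 'a) \<Rightarrow> ('a \<Rightarrow> 'a) \<Rightarrow> 'a \<Rightarrow> 'a \<Rightarrow> 'a"
  where "right_subadjacent G lhd \<Phi> a b = lhd a b \<otimes>\<^bsub>G\<^esub> \<Phi> b"

(* Closure of rhd and lhd on the carrier is part of the membership in iso G G. *)

locale left_twisted_post_group = group G for G (structure) +
  fixes rhd :: "'a \<Rightarrow> 'a \<Rightarrow> 'a" and \<Phi> :: "'a \<Rightarrow> 'a"
  assumes left_Phi_closed: "\<Phi> \<in> carrier G \<rightarrow> carrier G"
    and left_auto: "a \<in> carrier G \<Longrightarrow> rhd a \<in> iso G G"
    and left_action: "\<lbrakk>a \<in> carrier G; b \<in> carrier G; c \<in> carrier G\<rbrakk>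
      \<Longrightarrow> rhd (left_subadjacent G rhd \<Phi> a b) c = rhd a (rhd b c)"
    and left_Phi_subadjacent: "\<lbrakk>a \<in> carrier G; b \<in> carrier G\<rbrakk>
      \<Longrightarrow> \<Phi> (left_subadjacent G rhd \<Phi> a b) = left_subadjacent G rhd \<Phi> a (\<Phi> b)"

locale right_twisted_post_group = group G for G (structure) +
  fixes lhd :: "'a \<Rightarrow> 'a \<Rightarrow> 'a" and \<Phi> :: "'a \<Rightarrow> 'a"
  assumes right_Phi_closed: "\<Phi> \<in> carrier G \<rightarrow> carrier G"
    and right_auto: "b \<in> carrier G \<Longrightarrow> (\<lambda>a. lhd a b) \<in> iso G G"
    and right_action: "\<lbrakk>a \<in> carrier G; b \<in> carrier G; c \<in> carrier G\<rbrakk>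
      \<Longrightarrow> lhd a (right_subadjacent G lhd \<Phi> b c) = lhd (lhd a b) c"
    and right_Phi_subadjacent: "\<lbrakk>a \<in> carrier G; b \<in> carrier G\<rbrakk>
      \<Longrightarrow> \<Phi> (right_subadjacent G lhd \<Phi> a b) = right_subadjacent G lhd \<Phi> (\<Phi> a) b"

locale two_sided_twisted_post_group =
  left_twisted_post_group G rhd \<Phi> + right_twisted_post_group G lhd \<Phi>
  for G (structure) and rhd lhd :: "'a \<Rightarrow> 'a \<Rightarrow> 'a" and \<Phi> :: "'a \<Rightarrow> 'a" +
  assumes subadjacent_eq: "\<lbrakk>a \<in> carrier G; b \<in> carrier G\<rbrakk>
      \<Longrightarrow> left_subadjacent G rhd \<Phi> a b = right_subadjacent G lhd \<Phi> a b"

definition local_unit ::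
  "('a, 'm) monoid_scheme \<Rightarrow> ('a \<Rightarrow> 'a \<Rightarrow> 'a) \<Rightarrow> ('a \<Rightarrow> 'a) \<Rightarrow> 'a \<Rightarrow> 'a"
  where "local_unit G rhd \<Phi> a =
    inv_into (carrier G) (rhd a) (inv\<^bsub>G\<^esub> (\<Phi> a) \<otimes>\<^bsub>G\<^esub> a)"

definition dagger ::
  "('a, 'm) monoid_scheme \<Rightarrow> ('a \<Rightarrow> 'a \<Rightarrow> 'a) \<Rightarrow> ('a \<Rightarrow> 'a) \<Rightarrow> 'a \<Rightarrow> 'a"
  where "dagger G rhd \<Phi> a =
    inv_into (carrier G) (rhd a) (inv\<^bsub>G\<^esub> (\<Phi> a) \<otimes>\<^bsub>G\<^esub> local_unit G rhd \<Phi> a)"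

(* The second group structure is given by its operation alone; its identity element is
   existentially quantified (and is unique). *)

locale skew_brace_groups = group G for G (structure) +
  fixes circ :: "'a \<Rightarrow> 'a \<Rightarrow> 'a"
  assumes circ_group: "\<exists>e. group \<lparr>carrier = carrier G, mult = circ, one = e\<rparr>"

locale skew_left_brace = skew_brace_groups +
  assumes left_brace: "\<lbrakk>a \<in> carrier G; b \<in> carrier G; c \<in> carrier G\<rbrakk>
    \<Longrightarrow> circ a (b \<otimes> c) = circ a b \<otimes> inv a \<otimes> circ a c"

locale skew_right_brace = skew_brace_groups +
  assumes right_brace: "\<lbrakk>a \<in> carrier G; b \<in> carrier G; c \<in> carrier G\<rbrakk>
    \<Longrightarrow> circ (a \<otimes> b) c = circ a c \<otimes> inv c \<otimes> circ b c"

locale two_sided_skew_brace = skew_left_brace + skew_right_brace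

end

theory Submission
  imports Defs
begin

text \<open>
  The whole statement rests on the observation that the sub-adjacent operation \<open>\<circ>\<close> of a two-sided
  twisted post-group is a group operation, although neither one-sided structure forces this.
  Writing \<open>a \<circ> b = \<Phi>(a) \<cdot> (a \<rhd> b)\<close>, the axioms of the left structure give associativity, and they
  make every left translation of \<open>\<circ>\<close> an automorphism of \<open>(G, \<cdot>)\<close> followed by a translation of
  \<open>(G, \<cdot>)\<close>, hence bijective. The right structure does the same for right translations. A nonempty
  semigroup with bijective translations on both sides is a group. In that group \<open>e\<^sub>a\<close>, the solution
  of \<open>a \<circ> x = a\<close>, is the identity for every \<open>a\<close>, and \<open>a\<^sup>\<dagger>\<close>, the solution of \<open>a \<circ> x = e\<^sub>a\<close>, is the
  inverse of \<open>a\<close>.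

  Hence \<open>a \<bullet> b = a \<circ> 1\<^sup>\<dagger> \<circ> b\<close> is the group operation \<open>\<circ>\<close> re-based so that its identity becomes \<open>1\<close>.
  For the brace laws, put \<open>u = a \<circ> 1\<^sup>\<dagger>\<close>. As \<open>u \<rhd> _\<close> is an automorphism,
  \<open>u \<circ> (b \<cdot> c) = (u \<circ> b) \<cdot> \<Phi>(u)\<^sup>-\<^sup>1 \<cdot> (u \<circ> c)\<close>, and \<open>\<Phi>(u) = u \<circ> 1 = a\<close>, because \<open>u \<rhd> 1 = 1\<close>. This is the left brace law for \<open>\<bullet>\<close>. The right brace
  law follows in the same way from \<open>v = 1\<^sup>\<dagger> \<circ> c\<close>, for which \<open>\<Phi>(v) = 1 \<circ> v = c\<close>.
\<close>

section \<open>The sub-adjacent operation of a left twisted post-group\<close>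

context left_twisted_post_group
begin

abbreviation subadj (infixl "\<odot>" 70)
  where "a \<odot> b \<equiv> left_subadjacent G rhd \<Phi> a b"

lemma Phi_in_carrier: "a \<in> carrier G \<Longrightarrow> \<Phi> a \<in> carrier G"
  using left_Phi_closed by blast

lemma rhd_closed: "\<lbrakk>a \<in> carrier G; b \<in> carrier G\<rbrakk> \<Longrightarrow> rhd a b \<in> carrier G"
  using left_auto by (auto simp: iso_def hom_def)

lemma rhd_mult:
  "\<lbrakk>a \<in> carrier G; b \<in> carrier G; c \<in> carrier G\<rbrakk> \<Longrightarrow> rhd a (b \<otimes> c) = rhd a b \<otimes> rhd a c"
  using left_auto by (auto simp: iso_def hom_def)

lemma rhd_bij: "a \<in> carrier G \<Longrightarrow> bij_betw (rhd a) (carrier G) (carrier G)"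
  using left_auto by (auto simp: iso_def)

lemma subadj_closed: "\<lbrakk>a \<in> carrier G; b \<in> carrier G\<rbrakk> \<Longrightarrow> a \<odot> b \<in> carrier G"
  by (simp add: left_subadjacent_def Phi_in_carrier rhd_closed)

text \<open>
  Both sides equal \<open>\<Phi>(a) \<cdot> (a \<rhd> \<Phi>(b)) \<cdot> (a \<rhd> (b \<rhd> c))\<close>: the compatibility of \<open>\<Phi>\<close> with \<open>\<circ>\<close>
  supplies the first two factors of the left-hand side, the action law the third one.
\<close>
lemma subadj_assoc:
  assumes "a \<in> carrier G" "b \<in> carrier G" "c \<in> carrier G"
  shows "(a \<odot> b) \<odot> c = a \<odot> (b \<odot> c)"
proof -
  have "(a \<odot> b) \<odot> c = \<Phi> (a \<odot> b) \<otimes> rhd (a \<odot> b) c"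
    by (simp only: left_subadjacent_def)
  also have "\<dots> = (a \<odot> \<Phi> b) \<otimes> rhd a (rhd b c)"
    using assms by (simp only: left_Phi_subadjacent left_action)
  also have "\<dots> = \<Phi> a \<otimes> rhd a (\<Phi> b \<otimes> rhd b c)"
    using assms by (simp add: left_subadjacent_def Phi_in_carrier rhd_closed rhd_mult m_assoc)
  also have "\<dots> = a \<odot> (b \<odot> c)"
    by (simp only: left_subadjacent_def)
  finally show ?thesis .
qed

lemma subadj_left_cancel:
  assumes "a \<in> carrier G" "b \<in> carrier G" "c \<in> carrier G" "a \<odot> b = a \<odot> c"
  shows "b = c"
proof -
  have "rhd a b = rhd a c"
    using assms by (simp add: left_subadjacent_def Phi_in_carrier rhd_closed)
  then show ?thesis
    using assms rhd_bij by (auto simp: bij_betw_def inj_on_def)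
qed

text \<open>
  The expression \<open>(L\<^sub>a)\<^sup>-\<^sup>1(\<Phi>(a)\<^sup>-\<^sup>1 \<cdot> y)\<close>, which occurs in both \<open>e\<^sub>a\<close> and \<open>a\<^sup>\<dagger>\<close>, is the left division
  of \<open>y\<close> by \<open>a\<close> with respect to \<open>\<circ>\<close>.
\<close>
lemma subadj_left_division:
  assumes "a \<in> carrier G" "y \<in> carrier G"
  defines "x \<equiv> inv_into (carrier G) (rhd a) (inv (\<Phi> a) \<otimes> y)"
  shows "x \<in> carrier G" "a \<odot> x = y"
proof -
  have *: "inv (\<Phi> a) \<otimes> y \<in> rhd a ` carrier G"
    using assms rhd_bij by (simp add: bij_betw_def Phi_in_carrier)
  show "x \<in> carrier G"
    unfolding x_def using * by (rule inv_into_into)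
  have "rhd a x = inv (\<Phi> a) \<otimes> y"
    unfolding x_def using * by (rule f_inv_into_f)
  then show "a \<odot> x = y"
    using assms by (simp add: left_subadjacent_def Phi_in_carrier flip: m_assoc)
qed

lemmas local_unit_closed = subadj_left_division(1)[of a a for a, folded local_unit_def]
  and subadj_local_unit = subadj_left_division(2)[of a a for a, folded local_unit_def]

lemma dagger_closed: "a \<in> carrier G \<Longrightarrow> dagger G rhd \<Phi> a \<in> carrier G"
  unfolding dagger_def by (intro subadj_left_division(1) local_unit_closed)

lemma subadj_dagger: "a \<in> carrier G \<Longrightarrow> a \<odot> dagger G rhd \<Phi> a = local_unit G rhd \<Phi> a"
  unfolding dagger_def by (intro subadj_left_division(2) local_unit_closed)

lemma subadj_one_right:
  assumes "a \<in> carrier G"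
  shows "a \<odot> \<one> = \<Phi> a"
proof -
  have "rhd a \<one> = \<one>"
    using left_auto[OF assms] by (intro hom_one[of _ G G]) (auto simp: iso_def)
  then show ?thesis
    using assms by (simp add: left_subadjacent_def Phi_in_carrier)
qed

text \<open>
  This is the left brace law with \<open>\<Phi>(a)\<close> in place of \<open>a\<close> in the middle factor: the two factors
  \<open>\<Phi>(a)\<close> on the right contribute one too many, and the inverse removes it.
\<close>
lemma subadj_mult_right:
  assumes "a \<in> carrier G" "b \<in> carrier G" "c \<in> carrier G"
  shows "a \<odot> (b \<otimes> c) = (a \<odot> b) \<otimes> inv (\<Phi> a) \<otimes> (a \<odot> c)"
proof -
  have "inv (\<Phi> a) \<otimes> (a \<odot> c) = rhd a c"
    using assms by (simp add: left_subadjacent_def Phi_in_carrier rhd_closed flip: m_assoc)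
  then show ?thesis
    using assms
    by (simp add: left_subadjacent_def Phi_in_carrier rhd_closed rhd_mult m_assoc)
qed

end

section \<open>The sub-adjacent operation of a right twisted post-group\<close>

context right_twisted_post_group
begin

abbreviation subadj' (infixl "\<odot>''" 70)
  where "a \<odot>' b \<equiv> right_subadjacent G lhd \<Phi> a b"

lemma right_Phi_in_carrier: "a \<in> carrier G \<Longrightarrow> \<Phi> a \<in> carrier G"
  using right_Phi_closed by blast

lemma lhd_closed: "\<lbrakk>a \<in> carrier G; b \<in> carrier G\<rbrakk> \<Longrightarrow> lhd a b \<in> carrier G"
  using right_auto[of b] by (auto simp: iso_def hom_def)

lemma lhd_mult:
  "\<lbrakk>a \<in> carrier G; b \<in> carrier G; c \<in> carrier G\<rbrakk> \<Longrightarrow> lhd (a \<otimes> b) c = lhd a c \<otimes> lhd b c"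
  using right_auto[of c] by (auto simp: iso_def hom_def)

lemma lhd_bij: "b \<in> carrier G \<Longrightarrow> bij_betw (\<lambda>a. lhd a b) (carrier G) (carrier G)"
  using right_auto by (auto simp: iso_def)

lemma subadj'_right_division:
  assumes "b \<in> carrier G" "y \<in> carrier G"
  obtains x where "x \<in> carrier G" "x \<odot>' b = y"
proof -
  have "y \<otimes> inv (\<Phi> b) \<in> (\<lambda>a. lhd a b) ` carrier G"
    using assms lhd_bij by (simp add: bij_betw_def right_Phi_in_carrier)
  then obtain x where x: "x \<in> carrier G" "lhd x b = y \<otimes> inv (\<Phi> b)"
    by auto
  have "x \<odot>' b = y"
    using assms x by (simp add: right_subadjacent_def right_Phi_in_carrier m_assoc)
  with x(1) show thesis by (rule that)
qed

lemma subadj'_one_left: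
  assumes "b \<in> carrier G"
  shows "\<one> \<odot>' b = \<Phi> b"
proof -
  have "lhd \<one> b = \<one>"
    using right_auto[OF assms] hom_one[of "\<lambda>a. lhd a b" G G] by (auto simp: iso_def)
  then show ?thesis
    using assms by (simp add: right_subadjacent_def right_Phi_in_carrier)
qed

lemma subadj'_mult_left:
  assumes "a \<in> carrier G" "b \<in> carrier G" "c \<in> carrier G"
  shows "(a \<otimes> b) \<odot>' c = (a \<odot>' c) \<otimes> inv (\<Phi> c) \<otimes> (b \<odot>' c)"
  using assms
  by (simp add: right_subadjacent_def right_Phi_in_carrier lhd_closed lhd_mult m_assoc)

end

section \<open>The sub-adjacent group and its brace structure\<close>

text \<open>
  Inserting a fixed element \<open>d\<close> between the factors moves the identity to \<open>d\<^sup>-\<^sup>1\<close>: the translation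
  \<open>a \<mapsto> a \<cdot> d\<close> is an isomorphism from the new structure to the given group.
\<close>
lemma (in group) group_insert_factor:
  assumes d: "d \<in> carrier G"
    and op: "\<And>a b. \<lbrakk>a \<in> carrier G; b \<in> carrier G\<rbrakk> \<Longrightarrow> f a b = a \<otimes> d \<otimes> b"
  shows "group \<lparr>carrier = carrier G, mult = f, one = inv d\<rparr>"
proof (rule groupI, goal_cases)
  case (5 x)
  \<comment> \<open>In the given group, this is the solution \<open>y\<close> of \<open>y \<cdot> d \<cdot> x = d\<^sup>-\<^sup>1\<close>.\<close>
  have "f (inv d \<otimes> inv x \<otimes> inv d) x = inv d"
    using 5 d by (simp add: op m_assoc)
  then show ?case
    using 5 d by (intro bexI[of _ "inv d \<otimes> inv x \<otimes> inv d"]) auto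
qed (use d in \<open>auto simp: op m_assoc\<close>)

context two_sided_twisted_post_group
begin

definition subadj_group
  where "subadj_group = \<lparr>carrier = carrier G, mult = (\<odot>), one = local_unit G rhd \<Phi> \<one>\<rparr>"

lemma subadj_group_simps [simp]:
  "carrier subadj_group = carrier G"
  "mult subadj_group = (\<odot>)"
  "one subadj_group = local_unit G rhd \<Phi> \<one>"
  by (simp_all add: subadj_group_def)

text \<open>
  The solution \<open>e\<close> of \<open>1 \<circ> x = 1\<close> is a left identity because \<open>1 \<circ> (e \<circ> b) = 1 \<circ> b\<close> can be cancelled
  on the left. Left inverses are right quotients, so it is here that the right structure enters.
\<close>
lemma group_subadj_group: "group subadj_group"
proof (rule groupI, goal_cases)
  case (4 x)
  let ?e = "local_unit G rhd \<Phi> \<one>"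
  have x: "x \<in> carrier G" and e: "?e \<in> carrier G"
    using 4 by (simp_all add: local_unit_closed)
  have "\<one> \<odot> (?e \<odot> x) = \<one> \<odot> x"
    using x e by (simp add: subadj_local_unit flip: subadj_assoc)
  then have "?e \<odot> x = x"
    using x e by (simp add: subadj_left_cancel[of \<one>] subadj_closed)
  then show ?case by simp
next
  case (5 x)
  then obtain y where "y \<in> carrier G" "y \<odot>' x = local_unit G rhd \<Phi> \<one>"
    using subadj'_right_division[of x "local_unit G rhd \<Phi> \<one>"] by (auto intro: local_unit_closed)
  with 5 show ?case
    by (auto simp: subadjacent_eq)
qed (auto simp: subadj_closed subadj_assoc local_unit_closed)

sublocale S: group subadj_group
  by (rule group_subadj_group)

lemma dagger_one_eq_inv: "dagger G rhd \<Phi> \<one> = inv\<^bsub>subadj_group\<^esub> \<one>"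
proof (rule S.inv_equality[symmetric])
  show "dagger G rhd \<Phi> \<one> \<otimes>\<^bsub>subadj_group\<^esub> \<one> = \<one>\<^bsub>subadj_group\<^esub>"
    by (rule S.inv_comm) (simp_all add: subadj_dagger dagger_closed)
qed (simp_all add: dagger_closed)

end

theorem theorem4p16:
  fixes G :: "('a, 'm) monoid_scheme"
    and rhd lhd :: "'a \<Rightarrow> 'a \<Rightarrow> 'a"
    and \<Phi> :: "'a \<Rightarrow> 'a"
    and circ bullet :: "'a \<Rightarrow> 'a \<Rightarrow> 'a"
  assumes "two_sided_twisted_post_group G rhd lhd \<Phi>"
    and "\<And>a b. \<lbrakk>a \<in> carrier G; b \<in> carrier G\<rbrakk>
      \<Longrightarrow> circ a b = left_subadjacent G rhd \<Phi> a b"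
    and "\<And>a b. \<lbrakk>a \<in> carrier G; b \<in> carrier G\<rbrakk>
      \<Longrightarrow> bullet a b = circ (circ a (dagger G rhd \<Phi> \<one>\<^bsub>G\<^esub>)) b"
  shows "two_sided_skew_brace G bullet"
proof -
  interpret two_sided_twisted_post_group G rhd lhd \<Phi> by fact
  define d where "d = dagger G rhd \<Phi> \<one>\<^bsub>G\<^esub>"
  have d: "d \<in> carrier G"
    unfolding d_def by (rule dagger_closed) simp
  have d_inv: "d = inv\<^bsub>subadj_group\<^esub> \<one>\<^bsub>G\<^esub>"
    unfolding d_def by (rule dagger_one_eq_inv)
  have bullet: "bullet a b = (a \<odot> d) \<odot> b" if "a \<in> carrier G" "b \<in> carrier G" for a b
    using that d assms(2,3) by (simp add: d_def[symmetric] subadj_closed)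
  have "group \<lparr>carrier = carrier G, mult = bullet, one = inv\<^bsub>subadj_group\<^esub> d\<rparr>"
    using S.group_insert_factor[of d bullet] d bullet by simp
  then have grp: "\<exists>e. group \<lparr>carrier = carrier G, mult = bullet, one = e\<rparr>" ..
  \<comment> \<open>\<open>\<Phi>\<close> is right \<open>\<circ>\<close>-translation by \<open>1\<close> by the left structure, and left \<open>\<circ>\<close>-translation by \<open>1\<close>
    by the right structure. On either side it cancels \<open>d\<close>, the \<open>\<circ>\<close>-inverse of \<open>1\<close>.\<close>
  have Phi_left: "\<Phi> (a \<odot> d) = a" if a: "a \<in> carrier G" for a
  proof -
    have "\<Phi> (a \<odot> d) = (a \<odot> d) \<odot> \<one>\<^bsub>G\<^esub>"
      using a d by (simp add: subadj_one_right subadj_closed)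
    also have "\<dots> = a"
      using S.m_assoc[of a d "\<one>\<^bsub>G\<^esub>"] S.l_inv[of "\<one>\<^bsub>G\<^esub>"] S.r_one[of a] a d
      by (simp add: d_inv)
    finally show ?thesis .
  qed
  have Phi_right: "\<Phi> (d \<odot> c) = c" if c: "c \<in> carrier G" for c
  proof -
    have "\<Phi> (d \<odot> c) = \<one>\<^bsub>G\<^esub> \<odot> (d \<odot> c)"
      using c d by (simp add: subadj'_one_left subadj_closed subadjacent_eq[of "\<one>\<^bsub>G\<^esub>"])
    also have "\<dots> = c"
      using S.m_assoc[of "\<one>\<^bsub>G\<^esub>" d c] S.r_inv[of "\<one>\<^bsub>G\<^esub>"] S.l_one[of c] c d
      by (simp add: d_inv)
    finally show ?thesis .
  qed
  show ?thesis
  proof (unfold_locales, goal_cases)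
    case 1
    show ?case by (rule grp)
  next
    case (2 a b c)
    then show ?case
      using subadj_mult_right[of "a \<odot> d" b c] d by (simp add: bullet subadj_closed Phi_left)
  next
    case (3 a b c)
    then show ?case
      using subadj'_mult_left[of a b "d \<odot> c"] d
      by (simp add: bullet subadj_assoc subadj_closed Phi_right flip: subadjacent_eq)
  qed
qed

end
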